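(* Let $H\in\mathbb{R}^{n\times n}$ be entrywise nonnegative and let $A=\rho(H)I-H$ (a singular M-matrix). Suppose that $0$ is a geometrically simple eigenvalue of $A$, with left eigenvector $z_\ell\ne0$ ($z_\ell^TA=0$) and right eigenvector $z_r\neq0$ ($Az_r=0$). Let $v,w\in\mathbb{R}^n$ satisfy $(z_\ell^Tv)(w^Tz_r)\neq0$. Then $A+vw^T$ is D-stable in any of the following cases: (i) $n=2$, $v\ge0$, $w\ge0$, and at least one of the following holds: (a) $A$ is irreducible; (b) $v>0$ and $w>0$. (ii) $v>0$, $w>0$ and one of the following conditions holds, which are moreover equivalent to each other (for $v,w>0$): (a) there exists a positive diagonal matrix $D$ such that $DAD^{-1}$ and $Dvw^TD^{-1}$ are symmetric; (b) there exists a positive diagonal matrix $E$ such that $EA$ and $Evw^T$ are symmetric; (c) for $E=\operatorname{diag}(w)\operatorname{diag}(v)^{-1}$, the matrix $EA$ is symmetric. (iii) $v>0$, $w>0$ and $2h_{ij}\ge v_iw_j$ for all $i,j$.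
   Context: $\rho(M)$ is the spectral radius of $M$. For a vector or matrix, $\ge0$ (resp. $>0$) means that all entries are nonnegative (resp. positive). An M-matrix is a matrix $\gamma I-P$ with $P\ge0$ and $\gamma\ge\rho(P)$; it is a singular M-matrix if $\gamma=\rho(P)$. A matrix is strictly positive stable if all its eigenvalues have strictly positive real part. A positive diagonal matrix is a diagonal matrix with positive diagonal entries. A matrix $B\in\mathbb{R}^{n\times n}$ is D-stable if $DB$ is strictly positive stable for every positive diagonal matrix $D$. $\operatorname{diag}(x)$ is the diagonal matrix with the entries of the vector $x$ on the diagonal. An eigenvalue is geometrically simple if its eigenspace is one-dimensional. *)

theory Defs
  imports "Jordan_Normal_Form.Spectral_Radius" "Jordan_Normal_Form.Matrix_Kernel"
    "HOL-Combinatorics.Permutations"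
begin

definition nonneg_mat :: "real mat \<Rightarrow> bool" where
  "nonneg_mat M \<longleftrightarrow> (\<forall>i < dim_row M. \<forall>j < dim_col M. 0 \<le> M $$ (i, j))"

definition nonneg_vec :: "real vec \<Rightarrow> bool" where
  "nonneg_vec x \<longleftrightarrow> (\<forall>i < dim_vec x. 0 \<le> x $ i)"

(* Not the order-theoretic 0 < x, which would only exclude equality in 0 \<le> x. *)
definition pos_vec :: "real vec \<Rightarrow> bool" where
  "pos_vec x \<longleftrightarrow> (\<forall>i < dim_vec x. 0 < x $ i)"

definition symmetric_mat :: "'a mat \<Rightarrow> bool" where
  "symmetric_mat M \<longleftrightarrow> transpose_mat M = M"

definition real_spectral_radius :: "real mat \<Rightarrow> real" where
  "real_spectral_radius M = spectral_radius (map_mat complex_of_real M)"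

definition geometrically_simple :: "'a :: field mat \<Rightarrow> 'a \<Rightarrow> bool" where
  "geometrically_simple M k \<longleftrightarrow> kernel_dim (char_matrix M k) = 1"

definition strictly_positive_stable :: "real mat \<Rightarrow> bool" where
  "strictly_positive_stable M \<longleftrightarrow>
     (\<forall>\<mu>. eigenvalue (map_mat complex_of_real M) \<mu> \<longrightarrow> 0 < Re \<mu>)"

definition positive_diagonal_mat :: "nat \<Rightarrow> real mat \<Rightarrow> bool" where
  "positive_diagonal_mat n D \<longleftrightarrow>
     D \<in> carrier_mat n n \<and> diagonal_mat D \<and> (\<forall>i < n. 0 < D $$ (i, i))"

definition D_stable :: "real mat \<Rightarrow> bool" where
  "D_stable B \<longleftrightarrow>
     (\<forall>D. positive_diagonal_mat (dim_row B) D \<longrightarrow> strictly_positive_stable (D * B))"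

definition diag_of_vec :: "real vec \<Rightarrow> real mat" where
  "diag_of_vec x = mat_diag (dim_vec x) (\<lambda>i. x $ i)"

definition outer_mat :: "real vec \<Rightarrow> real vec \<Rightarrow> real mat" where
  "outer_mat x y = mat (dim_vec x) (dim_vec y) (\<lambda>(i, j). x $ i * y $ j)"

(* Unspecified when M is not invertible. *)
definition inverse_mat :: "'a :: field mat \<Rightarrow> 'a mat" where
  "inverse_mat M = the (mat_inverse M)"

(* Reducible: for some permutation matrix P, the matrix P M P^T is block upper triangular
   with square diagonal blocks of sizes k and n - k, both nonempty. In particular every
   1 x 1 matrix is irreducible. *)
definition irreducible_mat :: "real mat \<Rightarrow> bool" where
  "irreducible_mat M \<longleftrightarrow>
     (let n = dim_row M in
      \<not> (\<exists>p k. p permutes {..<n} \<and> 0 < k \<and> k < n \<and>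
             (\<forall>i j. k \<le> i \<longrightarrow> i < n \<longrightarrow> j < k \<longrightarrow> M $$ (p i, p j) = 0)))"

lemma inverse_mat_positive_diagonal:
  assumes "positive_diagonal_mat n D"
  shows "inverse_mat D = mat_diag n (\<lambda>i. inverse (D $$ (i, i)))"
proof -
  let ?B = "mat_diag n (\<lambda>i. inverse (D $$ (i, i)))"
  have D: "D \<in> carrier_mat n n" using assms by (simp add: positive_diagonal_mat_def)
  have eq: "D = mat_diag n (\<lambda>i. D $$ (i, i))"
    using assms by (intro eq_matI) (auto simp: positive_diagonal_mat_def diagonal_mat_def mat_diag_def)
  have nz: "\<And>i. i < n \<Longrightarrow> D $$ (i, i) \<noteq> 0"
    using assms by (force simp: positive_diagonal_mat_def)
  have 1: "mat_diag n (\<lambda>i. D $$ (i, i)) * ?B = 1\<^sub>m n" "?B * mat_diag n (\<lambda>i. D $$ (i, i)) = 1\<^sub>m n"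
    using nz by (auto simp: mat_diag_diag) (auto intro!: eq_matI simp: mat_diag_def)
  have DB: "D * ?B = 1\<^sub>m n" and BD: "?B * D = 1\<^sub>m n"
    using 1 unfolding eq[symmetric] by auto
  have "mat_inverse D \<noteq> None"
  proof
    assume "mat_inverse D = None"
    from mat_inverse(1)[OF D this, of "()"] show False
      using D DB BD by (auto simp: Units_def ring_mat_def)
  qed
  then obtain C where C: "mat_inverse D = Some C" by auto
  note C' = mat_inverse(2)[OF D C]
  have "C = (?B * D) * C" unfolding BD using C' left_mult_one_mat[of C n n] by simp
  also have "\<dots> = ?B * (D * C)" using assoc_mult_mat[of ?B n n D n C n] C' D by simp
  also have "\<dots> = ?B" using C' right_mult_one_mat[of ?B n n] by simp
  finally show ?thesis by (simp add: inverse_mat_def C)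
qed

end

theory Submission
  imports Defs
begin

text \<open>
  Perron-Frobenius theory is replaced by one growth estimate: for every s > \<rho>(H), the iterates
  H^k u are O(s^k). For H \<ge> 0 it shows that t u \<le> H u with 0 \<noteq> u \<ge> 0 forces t \<le> \<rho>(H); for H
  self-adjoint with respect to a weighted inner product, Cauchy-Schwarz gives
  (\<langle>x, H x\<rangle> / \<langle>x, x\<rangle>)^(2^m) \<le> \<langle>x, H^(2^m) x\<rangle> / \<langle>x, x\<rangle>, and hence Rayleigh quotients are at
  most \<rho>(H).

  Let B = A + v w^T. If B x = 0, then pairing with z_l gives w^T x = 0, so A x = 0, so x is a
  multiple of z_r, and w^T z_r \<noteq> 0 gives x = 0. Thus B is injective. Write an eigenvector equation
  of a scaled matrix as B x = \<mu> D x with D positive diagonal.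

  Case (iii): |H - v w^T| \<le> H entrywise, so Re \<mu> \<le> 0 would give
  \<rho>(H) |x| \<le> |\<rho>(H) - \<mu> D| |x| \<le> H |x|; since H > 0 these are equalities, which forces \<mu> = 0.
  Case (ii): with E = diag(w) diag(v)^(-1), the matrix E B = E A + w w^T is symmetric and positive
  semidefinite, so x^* E B x = \<mu> x^* E D x gives \<mu> \<ge> 0.
  Case (i): det B is a combination of the entries of adj A \<ge> 0 with coefficients v_i w_j, hence
  nonnegative, hence positive, and the trace of every positive row scaling of B is positive.
\<close>

section \<open>Matrices acting on functions of an index\<close>

definition mat_act :: "'a::semiring_0 mat \<Rightarrow> (nat \<Rightarrow> 'a) \<Rightarrow> nat \<Rightarrow> 'a" where
  "mat_act M x i = (\<Sum>j<dim_col M. M $$ (i, j) * x j)"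

lemma mult_mat_vec_eq_mat_act:
  assumes "i < dim_row M" "dim_vec x = dim_col M"
  shows "(M *\<^sub>v x) $ i = mat_act M (($) x) i"
  using assms by (simp add: mat_act_def scalar_prod_def lessThan_atLeast0)

lemma mat_act_cong:
  assumes "\<And>j. j < dim_col M \<Longrightarrow> x j = y j"
  shows "mat_act M x i = mat_act M y i"
  unfolding mat_act_def using assms by (intro sum.cong) auto

lemma eigenvalue_mat_act:
  assumes M: "M \<in> carrier_mat n n" and ev: "eigenvalue M k"
  obtains x where "\<exists>i<n. x i \<noteq> 0" "\<And>i. i < n \<Longrightarrow> mat_act M x i = k * x i"
proof -
  from ev obtain x where x: "x \<in> carrier_vec n" "x \<noteq> 0\<^sub>v n" "M *\<^sub>v x = k \<cdot>\<^sub>v x"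
    using M by (auto simp: eigenvalue_def eigenvector_def)
  have "\<exists>i<n. x $ i \<noteq> 0"
    using x(1,2) by (metis carrier_vecD eq_vecI index_zero_vec)
  moreover have "mat_act M (($) x) i = k * x $ i" if "i < n" for i
    using mult_mat_vec_eq_mat_act[of i M x] x M that by simp
  ultimately show thesis by (rule that)
qed

text \<open>Vectors are handled as plain functions of an index, so that iteration is
  \<open>^^\<close> and no carrier conditions arise. This ties the iterates to the powers
  \<open>M ^\<^sub>m k\<close>, for which growth bounds are available.\<close>

lemma pow_mat_mult_vec_eq_funpow:
  assumes M: "M \<in> carrier_mat n n" and "i < n"
  shows "(M ^\<^sub>m k *\<^sub>v vec n u) $ i = (mat_act M ^^ k) u i"
  using \<open>i < n\<close>
proof (induction k arbitrary: u i)
  case (Suc k)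
  have Mk: "M ^\<^sub>m k \<in> carrier_mat n n" using M by simp
  have eq: "M *\<^sub>v vec n u = vec n (mat_act M u)"
    using M by (intro eq_vecI)
      (auto simp: mult_mat_vec_eq_mat_act simp del: index_mult_mat_vec intro!: mat_act_cong)
  have "M ^\<^sub>m Suc k *\<^sub>v vec n u = M ^\<^sub>m k *\<^sub>v vec n (mat_act M u)"
    using assoc_mult_mat_vec[OF Mk M, of "vec n u"] eq by simp
  then show ?case using Suc.IH[OF Suc.prems] by (simp add: funpow_swap1)
qed (use M in auto)

lemma eigenvalue_smult:
  fixes M :: "'a::field mat"
  assumes M: "M \<in> carrier_mat n n" and a: "a \<noteq> 0" and ev: "eigenvalue (a \<cdot>\<^sub>m M) k"
  shows "eigenvalue M (k / a)"
proof -
  from ev obtain x where x: "x \<in> carrier_vec n" "x \<noteq> 0\<^sub>v n" "(a \<cdot>\<^sub>m M) *\<^sub>v x = k \<cdot>\<^sub>v x"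
    using M by (auto simp: eigenvalue_def eigenvector_def)
  have "a \<cdot>\<^sub>v (M *\<^sub>v x) = (a \<cdot>\<^sub>m M) *\<^sub>v x" using x(1) M by (intro eq_vecI) auto
  then have "a \<cdot>\<^sub>v (M *\<^sub>v x) = k \<cdot>\<^sub>v x" using x(3) by simp
  from arg_cong[OF this, of "\<lambda>y. inverse a \<cdot>\<^sub>v y"] have "M *\<^sub>v x = (k / a) \<cdot>\<^sub>v x"
    using a by (simp add: smult_smult_assoc field_simps)
  then show ?thesis using x M by (auto simp: eigenvalue_def eigenvector_def)
qed

lemma pow_mat_smult:
  fixes M :: "'a::comm_semiring_1 mat"
  assumes M: "M \<in> carrier_mat n n"
  shows "(a \<cdot>\<^sub>m M) ^\<^sub>m k = a ^ k \<cdot>\<^sub>m M ^\<^sub>m k"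
proof (induction k)
  case 0
  show ?case using M by (intro eq_matI) auto
next
  case (Suc k)
  have Mk: "M ^\<^sub>m k \<in> carrier_mat n n" using M by simp
  have "(a ^ k \<cdot>\<^sub>m M ^\<^sub>m k) * (a \<cdot>\<^sub>m M) = a ^ k \<cdot>\<^sub>m (a \<cdot>\<^sub>m (M ^\<^sub>m k * M))"
    using mult_smult_distrib[OF Mk M] mult_smult_assoc_mat[OF Mk, of "a \<cdot>\<^sub>m M" n] M by simp
  then show ?case using Suc M by (auto simp: mult_ac intro!: eq_matI)
qed

lemma real_spectral_radius_nonneg:
  assumes "H \<in> carrier_mat n n" "n > 0"
  shows "0 \<le> real_spectral_radius H"
  using spectral_radius_mem_max(1)[of "map_mat complex_of_real H" n] assms
  by (auto simp: real_spectral_radius_def)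

subsection \<open>Growth of iterates and the spectral radius\<close>

text \<open>Dividing \<open>H\<close> by \<open>s\<close> brings the spectral radius below 1, where
  Jordan normal forms give uniformly bounded powers. Multiplying back by \<open>s ^ k\<close> bounds
  the entries of the powers of \<open>H\<close>.\<close>

lemma funpow_mat_act_bound:
  assumes H: "H \<in> carrier_mat n n" and s: "real_spectral_radius H < s"
  obtains c where "\<And>k i. i < n \<Longrightarrow> \<bar>(mat_act H ^^ k) u i\<bar> \<le> c * s ^ k"
proof (cases "n = 0")
  case True
  then show ?thesis using that[of 0] by simp
next
  case False
  let ?C = "map_mat complex_of_real H"
  let ?G = "complex_of_real (1 / s) \<cdot>\<^sub>m ?C"
  have C: "?C \<in> carrier_mat n n" and G: "?G \<in> carrier_mat n n" using H by auto
  have s0: "s > 0" using real_spectral_radius_nonneg[OF H] s False by simp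
  have "spectral_radius ?G \<in> norm ` spectrum ?G" using spectral_radius_mem_max(1)[OF G] False by simp
  then obtain k where k: "eigenvalue ?G k" "spectral_radius ?G = norm k"
    by (auto simp: spectrum_def)
  have "eigenvalue ?C (k / complex_of_real (1 / s))" using eigenvalue_smult[OF C _ k(1)] s0 by simp
  then have "norm (k / complex_of_real (1 / s)) \<le> spectral_radius ?C"
    using spectral_radius_mem_max(2)[OF C] False by (auto simp: spectrum_def)
  moreover have "norm (k / complex_of_real (1 / s)) = norm k * s" using s0 by (simp add: norm_mult)
  ultimately have "norm k * s < 1 * s" using s by (simp add: real_spectral_radius_def)
  then have "spectral_radius ?G < 1" using s0 k(2) mult_less_cancel_right_pos by metis
  from spectral_radius_jnf_norm_bound_less_1_upper_triangular[OF G this]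
  obtain b where b: "\<And>k. norm_bound (?G ^\<^sub>m k) b" by auto
  have entry: "\<bar>(H ^\<^sub>m k) $$ (i, j)\<bar> \<le> b * s ^ k" if "i < n" "j < n" for i j k
  proof -
    have "?G ^\<^sub>m k = complex_of_real (1 / s) ^ k \<cdot>\<^sub>m map_mat complex_of_real (H ^\<^sub>m k)"
      using pow_mat_smult[OF C] of_real_hom.mat_hom_pow[OF H] by metis
    moreover have "norm ((?G ^\<^sub>m k) $$ (i, j)) \<le> b"
      using b[of k] that pow_carrier_mat[OF G, of k] unfolding norm_bound_def
      by (metis carrier_matD)
    ultimately have "\<bar>(H ^\<^sub>m k) $$ (i, j)\<bar> / s ^ k \<le> b"
      using that H s0 by (simp add: norm_mult norm_power norm_divide power_divide)
    then show ?thesis using s0 by (simp add: field_simps)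
  qed
  show ?thesis
  proof (rule that)
    fix k i assume i: "i < n"
    have "(mat_act H ^^ k) u i = (\<Sum>j<n. (H ^\<^sub>m k) $$ (i, j) * u j)"
      using H i pow_mat_mult_vec_eq_funpow[OF H i, of k u]
      by (simp add: scalar_prod_def lessThan_atLeast0)
    also have "\<bar>\<dots>\<bar> \<le> (\<Sum>j<n. b * s ^ k * \<bar>u j\<bar>)"
      using entry i by (intro order_trans[OF sum_abs] sum_mono) (simp add: abs_mult mult_right_mono)
    finally show "\<bar>(mat_act H ^^ k) u i\<bar> \<le> (b * (\<Sum>j<n. \<bar>u j\<bar>)) * s ^ k"
      by (simp add: sum_distrib_left sum_distrib_right mult_ac)
  qed
qed

text \<open>For t > s the powers of t / s along \<open>f\<close> would outgrow the constant c / q.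
  The exponent function \<open>f\<close> allows both the full sequence of iterates and the
  subsequence of powers of two.\<close>

lemma le_of_power_le_mult_power:
  fixes s t q c :: real
  assumes "s > 0" "q > 0" and bd: "\<And>m. q * t ^ f m \<le> c * s ^ f m"
    and f: "\<And>m::nat. m \<le> f m"
  shows "t \<le> s"
proof (rule ccontr)
  assume "\<not> t \<le> s"
  then have r: "t / s > 1" using assms(1) by simp
  then obtain m where m: "c / q < (t / s) ^ m" using real_arch_pow by blast
  also have "\<dots> \<le> (t / s) ^ f m" using r f by (intro power_increasing) auto
  finally have "c * s ^ f m < q * t ^ f m" using assms(1,2) by (simp add: power_divide field_simps)
  with bd[of m] show False by simp
qed

text \<open>A nonnegative \<open>H\<close> preserves inequalities, so for t >= 0 the hypothesis can
  be iterated to \<open>t ^ k * u i\<close> being at most the k-th iterate. Comparing with the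
  growth bound at an index where \<open>u\<close> is positive gives the claim.\<close>

lemma collatz_wielandt:
  assumes H: "H \<in> carrier_mat n n" "nonneg_mat H"
    and u: "\<And>i. i < n \<Longrightarrow> 0 \<le> u i" and ne: "i < n" "u i \<noteq> 0"
    and le: "\<And>i. i < n \<Longrightarrow> t * u i \<le> mat_act H u i"
  shows "t \<le> real_spectral_radius H"
proof (cases "t \<ge> 0")
  case True
  have pow: "t ^ k * u i \<le> (mat_act H ^^ k) u i" if "i < n" for k i
    using that
  proof (induction k arbitrary: i)
    case (Suc k)
    have "t ^ Suc k * u i = t ^ k * (t * u i)" by simp
    also have "\<dots> \<le> t ^ k * mat_act H u i" using le Suc.prems True by (simp add: mult_left_mono)
    also have "\<dots> = (\<Sum>j<n. H $$ (i, j) * (t ^ k * u j))"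
      using H by (simp add: mat_act_def sum_distrib_left mult_ac)
    also have "\<dots> \<le> (\<Sum>j<n. H $$ (i, j) * (mat_act H ^^ k) u j)"
      using H Suc by (intro sum_mono mult_left_mono) (auto simp: nonneg_mat_def)
    also have "\<dots> = mat_act H ((mat_act H ^^ k) u) i" using H(1) by (simp add: mat_act_def[of H])
    finally show ?case by simp
  qed simp
  \<comment> \<open>The growth bound is stated for \<open>s\<close> strictly above the spectral
    radius, so the inequality is proved for each such \<open>s\<close> and passes to the
    infimum.\<close>
  show ?thesis
  proof (rule dense_ge)
    fix s assume s: "real_spectral_radius H < s"
    obtain c where c: "\<And>k i. i < n \<Longrightarrow> \<bar>(mat_act H ^^ k) u i\<bar> \<le> c * s ^ k"
      using funpow_mat_act_bound[OF H(1) s] by blast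
    have "u i * t ^ m \<le> c * s ^ m" for m
      using pow[OF ne(1), of m] c[OF ne(1), of m] by (simp add: mult.commute)
    moreover have "u i > 0" using u[OF ne(1)] ne by simp
    moreover have "s > 0" using real_spectral_radius_nonneg[OF H(1)] s ne by simp
    ultimately show "t \<le> s" using le_of_power_le_mult_power[of s "u i" t "\<lambda>m. m" c] by simp
  qed
next
  case False
  then show ?thesis using real_spectral_radius_nonneg[OF H(1)] ne by simp
qed

lemma rayleigh_quotient_le:
  assumes H: "H \<in> carrier_mat n n" and e: "\<And>i. i < n \<Longrightarrow> 0 < e i"
    and sym: "\<And>i j. i < n \<Longrightarrow> j < n \<Longrightarrow> e i * H $$ (i, j) = e j * H $$ (j, i)"
  shows "(\<Sum>i<n. e i * x i * mat_act H x i) \<le> real_spectral_radius H * (\<Sum>i<n. e i * x i * x i)"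
proof (cases "\<exists>i<n. x i \<noteq> 0")
  case True
  define ip where "ip x y = (\<Sum>i<n. e i * x i * y i)" for x y :: "nat \<Rightarrow> real"
  define T where "T = mat_act H"
  have sa: "ip (T y) z = ip y (T z)" for y z
  proof -
    have "ip (T y) z = (\<Sum>i<n. \<Sum>j<n. e i * H $$ (i, j) * y j * z i)"
      using H by (simp add: ip_def T_def mat_act_def sum_distrib_left sum_distrib_right mult_ac)
    also have "\<dots> = (\<Sum>i<n. \<Sum>j<n. e j * H $$ (j, i) * y j * z i)"
      using sym by (intro sum.cong) auto
    also have "\<dots> = (\<Sum>j<n. \<Sum>i<n. e j * H $$ (j, i) * y j * z i)" by (rule sum.swap)
    also have "\<dots> = ip y (T z)"
      using H by (simp add: ip_def T_def mat_act_def sum_distrib_left mult_ac)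
    finally show ?thesis .
  qed
  \<comment> \<open>These moments take the place of the spectral theorem: self-adjointness makes the
    product of two iterates of \<open>x\<close> depend only on the total number of applications of
    \<open>T\<close>.\<close>
  define f where "f k = ip x ((T ^^ k) x)" for k
  have shift: "ip ((T ^^ k) x) ((T ^^ l) x) = f (k + l)" for k l
  proof (induction k arbitrary: l)
    case (Suc k)
    show ?case using sa[of "(T ^^ k) x"] Suc[of "Suc l"] by simp
  qed (simp add: f_def)
  have f0: "f 0 > 0"
  proof -
    obtain i where "i < n" "x i \<noteq> 0" using True by auto
    then have "0 < e i * x i * x i" using e by (auto simp: mult.assoc zero_less_mult_iff linorder_neq_iff)
    then have "0 < (\<Sum>i<n. e i * x i * x i)"
      using e \<open>i < n\<close> by (intro sum_pos2[of _ i]) (auto simp: mult.assoc less_imp_le)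
    then show ?thesis by (simp add: f_def ip_def)
  qed
  \<comment> \<open>Cauchy-Schwarz for \<open>x\<close> and its k-th iterate, read off from the
    squared norm of \<open>f 0 * ?y - f k * x\<close>, which is \<open>f 0\<close> times the Gram
    determinant.\<close>
  have cs: "(f k)\<^sup>2 \<le> f 0 * f (2 * k)" for k
  proof -
    let ?y = "(T ^^ k) x"
    have "0 \<le> (\<Sum>i<n. e i * (f 0 * ?y i - f k * x i)\<^sup>2)"
      using e by (intro sum_nonneg) (auto simp: less_imp_le)
    also have "\<dots> = (f 0)\<^sup>2 * ip ?y ?y - 2 * f 0 * f k * ip x ?y + (f k)\<^sup>2 * ip x x"
      by (simp add: ip_def sum_distrib_left power2_eq_square algebra_simps sum.distrib sum_subtractf)
    also have "\<dots> = f 0 * (f 0 * f (2 * k) - (f k)\<^sup>2)"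
      using shift[of k k] shift[of 0 k] shift[of 0 0]
      by (simp add: power2_eq_square algebra_simps flip: mult_2_right)
    finally show ?thesis using f0 by (simp add: zero_le_mult_iff)
  qed
  have "f 1 / f 0 \<le> real_spectral_radius H"
  \<comment> \<open>Squaring below needs a nonnegative quotient; a negative one is trivially below
    the spectral radius.\<close>
  proof (cases "f 1 \<ge> 0")
    case pos: True
    define t where "t = f 1 / f 0"
    have t: "t \<ge> 0" using pos f0 by (simp add: t_def)
    \<comment> \<open>Squaring the bound and applying \<open>cs\<close> doubles the exponent, which
      is why only powers of two occur.\<close>
    have pow: "f 0 * t ^ (2 ^ m) \<le> f (2 ^ m)" for m
    proof (induction m)
      case (Suc m)
      have "(f 0 * t ^ (2 ^ m))\<^sup>2 \<le> (f (2 ^ m))\<^sup>2" using Suc t f0 by (intro power_mono) auto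
      also have "\<dots> \<le> f 0 * f (2 ^ Suc m)" using cs[of "2 ^ m"] by simp
      finally have "f 0 * (f 0 * t ^ (2 ^ Suc m)) \<le> f 0 * f (2 ^ Suc m)"
        by (simp add: power_mult_distrib power2_eq_square mult_ac flip: power_add mult_2)
      then show ?case using f0 by simp
    qed (use f0 in \<open>simp add: t_def\<close>)
    show ?thesis unfolding t_def[symmetric]
    proof (rule dense_ge)
      fix s assume s: "real_spectral_radius H < s"
      obtain c where c: "\<And>k i. i < n \<Longrightarrow> \<bar>(T ^^ k) x i\<bar> \<le> c * s ^ k"
        using funpow_mat_act_bound[OF H s] unfolding T_def by blast
      have "f k \<le> (\<Sum>i<n. e i * \<bar>x i\<bar> * c) * s ^ k" for k
      proof -
        have "f k \<le> (\<Sum>i<n. e i * \<bar>x i\<bar> * (c * s ^ k))"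
          unfolding f_def ip_def
        proof (rule sum_mono)
          fix i assume "i \<in> {..<n}"
          then have i: "i < n" by simp
          have "e i * x i * (T ^^ k) x i \<le> \<bar>e i * x i * (T ^^ k) x i\<bar>" by simp
          also have "\<dots> = e i * \<bar>x i\<bar> * \<bar>(T ^^ k) x i\<bar>" using e[OF i] by (simp add: abs_mult)
          also have "\<dots> \<le> e i * \<bar>x i\<bar> * (c * s ^ k)"
            using c[OF i] e[OF i] by (intro mult_left_mono) auto
          finally show "e i * x i * (T ^^ k) x i \<le> e i * \<bar>x i\<bar> * (c * s ^ k)" .
        qed
        then show ?thesis by (simp add: sum_distrib_right mult.assoc)
      qed
      then have "f 0 * t ^ (2 ^ m) \<le> (\<Sum>i<n. e i * \<bar>x i\<bar> * c) * s ^ (2 ^ m)" for m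
        using pow order_trans by blast
      moreover have "s > 0" using real_spectral_radius_nonneg[OF H] s True by fastforce
      moreover have "m \<le> 2 ^ m" for m :: nat by (simp add: less_imp_le)
      ultimately show "t \<le> s" using f0 le_of_power_le_mult_power[of s "f 0" t "\<lambda>m. 2 ^ m"] by blast
    qed
  next
    case False
    then have "f 1 / f 0 \<le> 0" using f0 by (simp add: divide_nonpos_pos)
    then show ?thesis using real_spectral_radius_nonneg[OF H] True by fastforce
  qed
  then show ?thesis using f0 by (simp add: f_def ip_def T_def field_simps)
qed simp

subsection \<open>Rank-one updates\<close>

text \<open>An eigenvector is a linearly independent singleton in the kernel of
  \<open>char_matrix A k\<close>; since that kernel has dimension one, the singleton is a basis and
  spans it.\<close>

lemma geometrically_simple_kernel:
  assumes A: "A \<in> carrier_mat n n" and simple: "geometrically_simple A k"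
    and z: "eigenvector A z k" and y: "y \<in> carrier_vec n" "A *\<^sub>v y = k \<cdot>\<^sub>v y"
  obtains a where "y = a \<cdot>\<^sub>v z"
proof (cases "y = 0\<^sub>v n")
  case True
  moreover have "z \<in> carrier_vec n" using z A by (auto simp: eigenvector_def)
  ultimately have "y = 0 \<cdot>\<^sub>v z" by (intro eq_vecI) auto
  then show ?thesis by (rule that)
next
  case False
  let ?C = "char_matrix A k"
  have C: "?C \<in> carrier_mat n n" using A by simp
  interpret K: kernel n n ?C by unfold_locales (rule C)
  have zk: "z \<in> mat_kernel ?C" "z \<noteq> 0\<^sub>v n"
    using z eigenvector_char_matrix[OF A] mat_kernelI[OF C] by auto
  have "eigenvector A y k" using y False A by (auto simp: eigenvector_def)
  then have yk: "y \<in> mat_kernel ?C"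
    using eigenvector_char_matrix[OF A] mat_kernelI[OF C] by auto
  have li: "K.lin_indpt {z}"
    using K.Ker.finite_lin_indpt2 K.Ker.lin_dep_iff_in_span K.Ker.span_empty zk
    by (metis empty_iff empty_subsetI finite.emptyI insert_iff insert_subset insert_union)
  have fd: "K.Ker.fin_dim" using kernel_basis_exists[OF C]
    by (metis K.Ker.basis_def K.Ker.fin_dim_def)
  have "K.dim = 1" using simple unfolding geometrically_simple_def by simp
  then have "K.basis {z}" using li zk fd by (intro K.Ker.dim_li_is_basis) auto
  then have "y \<in> K.span {z}" using yk by (simp add: K.Ker.basis_def)
  then obtain a where "y = K.lincomb a {z}"
    using K.Ker.finite_span[of "{z}"] zk by auto
  then have "y = a z \<cdot>\<^sub>v z" using zk K.Ker.lincomb_def by simp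
  then show ?thesis by (rule that)
qed

section \<open>D-stability as a weighted eigenvector condition\<close>

lemma Re_mat_act:
  assumes "i < dim_row M"
  shows "Re (mat_act (map_mat complex_of_real M) x i) = mat_act M (\<lambda>j. Re (x j)) i"
  using assms by (simp add: mat_act_def)

lemma Im_mat_act:
  assumes "i < dim_row M"
  shows "Im (mat_act (map_mat complex_of_real M) x i) = mat_act M (\<lambda>j. Im (x j)) i"
  using assms by (simp add: mat_act_def)

lemma mat_diag_of_positive_diagonal:
  assumes "positive_diagonal_mat n D"
  shows "mat_diag n (\<lambda>i. D $$ (i, i)) = D"
  using assms by (intro eq_matI) (auto simp: positive_diagonal_mat_def diagonal_mat_def mat_diag_def)

text \<open>Here \<open>d\<close> is the diagonal of the inverse of the scaling matrix in the definition of
  D-stability.\<close>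

lemma D_stableI:
  assumes B: "B \<in> carrier_mat n n"
    and stable: "\<And>d x \<mu>. \<lbrakk>\<And>i. i < n \<Longrightarrow> 0 < d i; \<exists>i<n. x i \<noteq> 0;
        \<And>i. i < n \<Longrightarrow> mat_act (map_mat complex_of_real B) x i = \<mu> * complex_of_real (d i) * x i\<rbrakk>
        \<Longrightarrow> 0 < Re \<mu>"
  shows "D_stable B"
  unfolding D_stable_def strictly_positive_stable_def
proof (intro allI impI)
  fix D \<mu>
  assume D: "positive_diagonal_mat (dim_row B) D"
    and ev: "eigenvalue (map_mat complex_of_real (D * B)) \<mu>"
  \<comment> \<open>Inside this proof \<open>d\<close> is the diagonal of \<open>D\<close> itself;
    its reciprocal is what \<open>stable\<close> receives at the end.\<close>
  define d where "d i = D $$ (i, i)" for i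
  have d: "0 < d i" if "i < n" for i using D B that by (simp add: positive_diagonal_mat_def d_def)
  have "mat_diag n d = D"
    using mat_diag_of_positive_diagonal[OF D] B by (simp add: d_def[abs_def])
  then have DB: "D * B = mat n n (\<lambda>(i, j). d i * B $$ (i, j))"
    using mat_diag_mult_left[OF B, of d] by simp
  obtain x where x: "\<exists>i<n. x i \<noteq> 0"
    and ex: "\<And>i. i < n \<Longrightarrow> mat_act (map_mat complex_of_real (D * B)) x i = \<mu> * x i"
    using eigenvalue_mat_act[OF _ ev, of n] DB by auto
  have "mat_act (map_mat complex_of_real (D * B)) x i
      = complex_of_real (d i) * mat_act (map_mat complex_of_real B) x i" if "i < n" for i
    using that B by (simp add: DB mat_act_def sum_distrib_left mult.assoc)
  then have "mat_act (map_mat complex_of_real B) x i = \<mu> * complex_of_real (1 / d i) * x i" if "i < n" for i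
    using ex[OF that] d[OF that] that by (simp add: field_simps)
  with d x show "0 < Re \<mu>" by (intro stable[of "\<lambda>i. 1 / d i" x \<mu>]) auto
qed

lemma mult_mat_vec_rank_one_update:
  fixes A :: "real mat"
  assumes "A \<in> carrier_mat n n" "v \<in> carrier_vec n" "w \<in> carrier_vec n" "y \<in> carrier_vec n"
  shows "(A + outer_mat v w) *\<^sub>v y = A *\<^sub>v y + (w \<bullet> y) \<cdot>\<^sub>v v"
  using assms by (intro eq_vecI)
    (auto simp: outer_mat_def scalar_prod_def algebra_simps sum.distrib sum_distrib_left)

lemma rank_one_update_nonsingular:
  fixes A :: "real mat"
  assumes A: "A \<in> carrier_mat n n" and simple: "geometrically_simple A 0"
    and left: "eigenvector (transpose_mat A) z_l 0"
    and right: "eigenvector A z_r 0"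
    and v: "v \<in> carrier_vec n" and w: "w \<in> carrier_vec n"
    and nz: "(z_l \<bullet> v) * (w \<bullet> z_r) \<noteq> 0"
    and x: "\<And>i. i < n \<Longrightarrow> mat_act (A + outer_mat v w) x i = 0" and "i < n"
  shows "x i = 0"
proof -
  let ?y = "vec n x"
  have zl: "z_l \<in> carrier_vec n" "transpose_mat A *\<^sub>v z_l = 0\<^sub>v n"
    and zr: "z_r \<in> carrier_vec n"
    using left right A by (auto simp: eigenvector_def)
  have B: "A + outer_mat v w \<in> carrier_mat n n" using A v w by (simp add: outer_mat_def)
  have "(A + outer_mat v w) *\<^sub>v ?y = 0\<^sub>v n"
  proof (rule eq_vecI)
    fix i assume "i < dim_vec (0\<^sub>v n)"
    then show "((A + outer_mat v w) *\<^sub>v ?y) $ i = 0\<^sub>v n $ i"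
      using x[of i] B mult_mat_vec_eq_mat_act[of i "A + outer_mat v w" ?y]
        mat_act_cong[of "A + outer_mat v w" "($) ?y" x i]
      by (simp del: index_mult_mat_vec dim_vec index_add_mat)
  qed (use B in auto)
  then have upd: "A *\<^sub>v ?y + (w \<bullet> ?y) \<cdot>\<^sub>v v = 0\<^sub>v n"
    using mult_mat_vec_rank_one_update[OF A v w, of ?y] by simp
  \<comment> \<open>Pairing with the left null vector removes \<open>A\<close> and leaves the
    product of \<open>w \<bullet> ?y\<close> and \<open>z_l \<bullet> v\<close>, whose second factor
    is nonzero by \<open>nz\<close>.\<close>
  have "z_l \<bullet> (A *\<^sub>v ?y) = 0"
    using transpose_vec_mult_scalar[OF A, of ?y z_l] zl by simp
  then have "(w \<bullet> ?y) * (z_l \<bullet> v) = z_l \<bullet> (A *\<^sub>v ?y + (w \<bullet> ?y) \<cdot>\<^sub>v v)"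
    using zl v A by (simp add: scalar_prod_add_distrib[of _ n])
  then have wy: "w \<bullet> ?y = 0" using upd zl nz by auto
  \<comment> \<open>The rank-one term has dropped out, so \<open>?y\<close> lies in the kernel of
    \<open>A\<close> and is a multiple of \<open>z_r\<close>; as \<open>w \<bullet> z_r\<close> is
    nonzero, the multiple is zero.\<close>
  then have "A *\<^sub>v ?y = 0 \<cdot>\<^sub>v ?y" using upd A v by (intro eq_vecI) (auto simp: vec_eq_iff)
  then obtain a where a: "?y = a \<cdot>\<^sub>v z_r"
    using geometrically_simple_kernel[OF A simple right, of ?y] by auto
  then have "a * (w \<bullet> z_r) = 0" using wy w zr by simp
  then have "a = 0" using nz by simp
  then show ?thesis using arg_cong[OF a, of "\<lambda>y. y $ i"] \<open>i < n\<close> zr by simp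
qed

definition real_injective :: "nat \<Rightarrow> real mat \<Rightarrow> bool" where
  "real_injective n B \<longleftrightarrow> (\<forall>x. (\<forall>i<n. mat_act B x i = 0) \<longrightarrow> (\<forall>i<n. x i = 0))"

text \<open>A real matrix acts separately on real and imaginary parts, so a complex null vector
  splits into two real ones.\<close>

lemma real_injective_complex:
  assumes B: "B \<in> carrier_mat n n" "real_injective n B"
    and x: "\<And>i. i < n \<Longrightarrow> mat_act (map_mat complex_of_real B) x i = 0" and "i < n"
  shows "x i = 0"
proof -
  have "mat_act B (\<lambda>j. Re (x j)) i = 0" "mat_act B (\<lambda>j. Im (x j)) i = 0" if "i < n" for i
    using Re_mat_act[of i B x] Im_mat_act[of i B x] x[OF that] B(1) that by auto
  with B(2) \<open>i < n\<close> have "Re (x i) = 0" "Im (x i) = 0"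
    unfolding real_injective_def by blast+
  then show ?thesis by (simp add: complex_eq_iff)
qed

section \<open>Positive matrices and entrywise domination: case (iii)\<close>

lemma positive_mat_subinvariant:
  assumes H: "H \<in> carrier_mat n n" "\<And>i j. i < n \<Longrightarrow> j < n \<Longrightarrow> 0 < H $$ (i, j)"
    and u: "\<And>i. i < n \<Longrightarrow> 0 \<le> u i" "\<exists>i<n. u i \<noteq> 0"
    and le: "\<And>i. i < n \<Longrightarrow> real_spectral_radius H * u i \<le> mat_act H u i"
    and "i < n"
  shows "mat_act H u i = real_spectral_radius H * u i" "0 < real_spectral_radius H * u i"
proof -
  let ?r = "real_spectral_radius H"
  have nonneg: "nonneg_mat H" using H by (auto simp: nonneg_mat_def less_imp_le)
  have pos: "0 < mat_act H x i" if x: "\<And>j. j < n \<Longrightarrow> 0 \<le> x j" and k: "k < n" "0 < x k" and "i < n"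
    for x i k
  proof -
    have "0 < H $$ (i, k) * x k" using H(2) k that by simp
    also have "\<dots> \<le> (\<Sum>j<n. H $$ (i, j) * x j)"
      using H(2) k x \<open>i < n\<close> by (intro member_le_sum) (auto simp: less_imp_le)
    finally show ?thesis using H(1) by (simp add: mat_act_def)
  qed
  define y where "y = mat_act H u"
  obtain k where k: "k < n" "0 < u k" using u by (metis order_le_less)
  have y: "0 < y j" if "j < n" for j unfolding y_def using pos[of u k j] u(1) k that by simp
  \<comment> \<open>A strict inequality in one coordinate would, after one more application of the
    positive matrix, become strict in all coordinates for \<open>y\<close>.\<close>
  have eq: "y j = ?r * u j" if "j < n" for j
  proof (rule ccontr)
    assume "y j \<noteq> ?r * u j"
    then have gt: "0 < y j - ?r * u j" using le[OF that] by (simp add: y_def)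
    have step: "?r * y i < mat_act H y i" if "i < n" for i
    proof -
      have "0 < mat_act H (\<lambda>j. y j - ?r * u j) i"
        using le gt \<open>j < n\<close> \<open>i < n\<close> by (intro pos[of _ j]) (auto simp: y_def)
      also have "\<dots> = mat_act H y i - ?r * mat_act H u i"
        by (simp add: mat_act_def algebra_simps sum_subtractf sum_distrib_left)
      finally show ?thesis by (simp add: y_def)
    qed
    \<comment> \<open>The smallest of the finitely many ratios is the largest factor that
      \<open>collatz_wielandt\<close> can be given for \<open>y\<close>; all ratios exceed the
      spectral radius, hence so does \<open>t\<close>.\<close>
    define t where "t = Min ((\<lambda>i. mat_act H y i / y i) ` {..<n})"
    have "t * y i \<le> mat_act H y i" if "i < n" for i
    proof -
      have "t \<le> mat_act H y i / y i" unfolding t_def using that by (intro Min_le) auto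
      then show ?thesis using y[OF that] by (simp add: field_simps)
    qed
    moreover have "y k \<noteq> 0" using y[OF k(1)] by simp
    ultimately have "t \<le> ?r"
      using collatz_wielandt[OF H(1) nonneg, of y k t] y k(1) by (simp add: less_imp_le)
    moreover have "?r < t" unfolding t_def using step y k by (subst Min_gr_iff) (auto simp: field_simps)
    ultimately show False by simp
  qed
  from eq[OF \<open>i < n\<close>] y[OF \<open>i < n\<close>]
  show "mat_act H u i = ?r * u i" "0 < ?r * u i" by (simp_all add: y_def)
qed

lemma mat_act_rank_one_update:
  fixes \<rho> :: real
  assumes "H \<in> carrier_mat n n" "v \<in> carrier_vec n" "w \<in> carrier_vec n" "i < n"
  shows "mat_act (\<rho> \<cdot>\<^sub>m 1\<^sub>m n - H + outer_mat v w) x i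
    = \<rho> * x i - mat_act H x i + v $ i * (\<Sum>j<n. w $ j * x j)"
proof -
  have "mat_act (\<rho> \<cdot>\<^sub>m 1\<^sub>m n - H + outer_mat v w) x i
      = (\<Sum>j<n. (if j = i then \<rho> * x j else 0) - H $$ (i, j) * x j + v $ i * (w $ j * x j))"
    using assms unfolding mat_act_def
    by (intro sum.cong) (auto simp: outer_mat_def algebra_simps)
  also have "\<dots> = \<rho> * x i - mat_act H x i + v $ i * (\<Sum>j<n. w $ j * x j)"
    using assms by (simp add: sum.distrib sum_subtractf mat_act_def sum_distrib_left)
  finally show ?thesis .
qed

lemma D_stable_of_dominated:
  assumes H: "H \<in> carrier_mat n n"
    and v: "v \<in> carrier_vec n" "pos_vec v" and w: "w \<in> carrier_vec n" "pos_vec w"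
    and dom: "\<And>i j. i < n \<Longrightarrow> j < n \<Longrightarrow> v $ i * w $ j \<le> 2 * H $$ (i, j)"
    and B: "B = real_spectral_radius H \<cdot>\<^sub>m 1\<^sub>m n - H + outer_mat v w"
    and inj: "real_injective n B"
  shows "D_stable B"
proof (rule D_stableI[where n = n])
  let ?r = "real_spectral_radius H"
  show Bc: "B \<in> carrier_mat n n" using B H v w by (simp add: outer_mat_def)
  fix d :: "nat \<Rightarrow> real" and x :: "nat \<Rightarrow> complex" and \<mu> :: complex
  assume d: "\<And>i. i < n \<Longrightarrow> 0 < d i" and x: "\<exists>i<n. x i \<noteq> 0"
    and ev: "\<And>i. i < n \<Longrightarrow> mat_act (map_mat complex_of_real B) x i = \<mu> * complex_of_real (d i) * x i"
  have vw: "0 < v $ i * w $ j" if "i < n" "j < n" for i j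
    using v w that by (auto simp: pos_vec_def)
  then have Hpos: "0 < H $$ (i, j)" if "i < n" "j < n" for i j
    using dom[OF that] that by (smt (verit))
  define u where "u i = norm (x i)" for i
  have key: "norm (complex_of_real ?r - \<mu> * complex_of_real (d i)) * u i \<le> mat_act H u i"
    if "i < n" for i
  proof -
    have "mat_act (map_mat complex_of_real B) x i
        = (\<Sum>j<n. (if j = i then complex_of_real ?r * x j else 0)
            - complex_of_real (H $$ (i, j) - v $ i * w $ j) * x j)"
      using H v w Bc that unfolding mat_act_def
      by (intro sum.cong) (auto simp: B outer_mat_def algebra_simps)
    also have "\<dots> = complex_of_real ?r * x i
        - (\<Sum>j<n. complex_of_real (H $$ (i, j) - v $ i * w $ j) * x j)"
      using that by (simp add: sum_subtractf)
    \<comment> \<open>The eigenvector equation is rearranged so that the matrix on the right is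
      \<open>H\<close> minus the rank-one term, whose entries are dominated in modulus by those of
      \<open>H\<close>.\<close>
    finally have "(complex_of_real ?r - \<mu> * complex_of_real (d i)) * x i
        = (\<Sum>j<n. complex_of_real (H $$ (i, j) - v $ i * w $ j) * x j)"
      using ev[OF that] by (simp add: algebra_simps)
    then have "norm (complex_of_real ?r - \<mu> * complex_of_real (d i)) * u i
        = norm (\<Sum>j<n. complex_of_real (H $$ (i, j) - v $ i * w $ j) * x j)"
      unfolding u_def by (metis norm_mult)
    also have "\<dots> \<le> (\<Sum>j<n. H $$ (i, j) * u j)"
    proof (rule sum_norm_le)
      fix j assume "j \<in> {..<n}"
      then have "\<bar>H $$ (i, j) - v $ i * w $ j\<bar> \<le> H $$ (i, j)"
        using dom[OF that, of j] vw[OF that, of j] by auto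
      then show "norm (complex_of_real (H $$ (i, j) - v $ i * w $ j) * x j) \<le> H $$ (i, j) * u j"
        unfolding u_def norm_mult norm_of_real by (intro mult_right_mono) auto
    qed
    finally show ?thesis using H by (simp add: mat_act_def)
  qed
  have r0: "0 \<le> ?r" using real_spectral_radius_nonneg[OF H(1)] x by fastforce
  show "0 < Re \<mu>"
  proof (rule ccontr)
    assume neg: "\<not> 0 < Re \<mu>"
    \<comment> \<open>For \<open>\<mu>\<close> in the closed left half-plane, subtracting a positive
      multiple of it from \<open>?r\<close> can only increase the real part.\<close>
    have far: "?r \<le> norm (complex_of_real ?r - \<mu> * complex_of_real (d i))" if "i < n" for i
    proof -
      have "?r \<le> Re (complex_of_real ?r - \<mu> * complex_of_real (d i))"
        using neg d[OF that] by (simp add: mult_nonpos_nonneg)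
      also have "\<dots> \<le> norm (complex_of_real ?r - \<mu> * complex_of_real (d i))" by (rule complex_Re_le_cmod)
      finally show ?thesis .
    qed
    have "?r * u i \<le> mat_act H u i" if "i < n" for i
      using mult_right_mono[OF far[OF that], of "u i"] key[OF that] by (simp add: u_def)
    note sub = positive_mat_subinvariant[OF H(1) Hpos, of u, OF _ _ _ _ this]
    obtain i where i: "i < n" using x by auto
    have "mat_act H u i = ?r * u i" "0 < ?r * u i" using sub[of i] x i by (auto simp: u_def)
    \<comment> \<open>Equality in the subinvariance and \<open>u i\<close> positive allow cancelling
      \<open>u i\<close> in \<open>key\<close>, the reverse of \<open>far\<close>.\<close>
    with key[OF i] have "norm (complex_of_real ?r - \<mu> * complex_of_real (d i)) \<le> ?r" and r: "0 < ?r"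
      using r0 by (auto simp: u_def zero_less_mult_iff)
    then have "(norm (complex_of_real ?r - \<mu> * complex_of_real (d i)))\<^sup>2 \<le> ?r\<^sup>2"
      by (intro power_mono) auto
    then have "(?r - Re \<mu> * d i)\<^sup>2 + (Im \<mu> * d i)\<^sup>2 \<le> ?r\<^sup>2"
      by (simp add: cmod_power2)
    moreover have "(?r - Re \<mu> * d i)\<^sup>2 = ?r\<^sup>2 - 2 * ?r * (Re \<mu> * d i) + (Re \<mu> * d i)\<^sup>2"
      by (simp add: power2_eq_square algebra_simps)
    \<comment> \<open>Geometrically, the closed disc of radius \<open>?r\<close> about
      \<open>?r\<close> meets the closed left half-plane only at 0, so \<open>\<mu> * d i\<close>
      vanishes.\<close>
    moreover have "2 * ?r * (Re \<mu> * d i) \<le> 0"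
      using neg r d[OF i] by (intro mult_nonneg_nonpos mult_nonpos_nonneg) auto
    ultimately have "(Re \<mu> * d i)\<^sup>2 + (Im \<mu> * d i)\<^sup>2 \<le> 0" by linarith
    then have "\<mu> = 0" using d[OF i] by (simp add: sum_power2_le_zero_iff complex_eq_iff)
    then have "x i = 0" if "i < n" for i
      using real_injective_complex[OF Bc inj, of x] ev that by simp
    with x show False by auto
  qed
qed

section \<open>Symmetrizable updates: case (ii)\<close>

lemma D_stable_of_symmetrizable:
  assumes H: "H \<in> carrier_mat n n"
    and v: "v \<in> carrier_vec n" and w: "w \<in> carrier_vec n"
    and e: "\<And>i. i < n \<Longrightarrow> 0 < e i" "\<And>i. i < n \<Longrightarrow> w $ i = e i * v $ i"
    and sym: "\<And>i j. i < n \<Longrightarrow> j < n \<Longrightarrow> e i * H $$ (i, j) = e j * H $$ (j, i)"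
    and B: "B = real_spectral_radius H \<cdot>\<^sub>m 1\<^sub>m n - H + outer_mat v w"
    and inj: "real_injective n B"
  shows "D_stable B"
proof (rule D_stableI[where n = n])
  let ?r = "real_spectral_radius H"
  show Bc: "B \<in> carrier_mat n n" using B H v w by (simp add: outer_mat_def)
  fix d :: "nat \<Rightarrow> real" and x :: "nat \<Rightarrow> complex" and \<mu> :: complex
  assume d: "\<And>i. i < n \<Longrightarrow> 0 < d i" and x: "\<exists>i<n. x i \<noteq> 0"
    and ev: "\<And>i. i < n \<Longrightarrow> mat_act (map_mat complex_of_real B) x i = \<mu> * complex_of_real (d i) * x i"
  define p q where "p i = Re (x i)" and "q i = Im (x i)" for i
  have re: "mat_act B p i = d i * (Re \<mu> * p i - Im \<mu> * q i)"
    and im: "mat_act B q i = d i * (Re \<mu> * q i + Im \<mu> * p i)" if "i < n" for i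
    using Re_mat_act[of i B x] Im_mat_act[of i B x] ev[OF that] Bc that
    by (auto simp: p_def[abs_def] q_def[abs_def] algebra_simps)
  \<comment> \<open>Since \<open>e i * v $ i = w $ i\<close>, weighting the rank-one term by
    \<open>e\<close> gives the square of the product of \<open>w\<close> and \<open>y\<close>; the
    remaining part is nonnegative by the Rayleigh bound.\<close>
  have psd: "0 \<le> (\<Sum>i<n. e i * y i * mat_act B y i)" for y
  proof -
    have "(\<Sum>i<n. e i * y i * mat_act B y i)
        = (\<Sum>i<n. ?r * (e i * y i * y i) - e i * y i * mat_act H y i
            + w $ i * y i * (\<Sum>j<n. w $ j * y j))"
      by (intro sum.cong) (auto simp: B mat_act_rank_one_update[OF H v w] e(2) algebra_simps)
    also have "\<dots> = ?r * (\<Sum>i<n. e i * y i * y i) - (\<Sum>i<n. e i * y i * mat_act H y i)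
        + (\<Sum>j<n. w $ j * y j)\<^sup>2"
      by (simp add: sum.distrib sum_subtractf power2_eq_square flip: sum_distrib_left sum_distrib_right)
    finally show ?thesis using rayleigh_quotient_le[OF H e(1) sym, of y] by simp
  qed
  have symB: "e i * B $$ (i, j) = e j * B $$ (j, i)" if "i < n" "j < n" for i j
    using that sym[OF that] H v w by (auto simp: B outer_mat_def e(2) algebra_simps)
  have "(\<Sum>i<n. e i * p i * mat_act B q i) = (\<Sum>i<n. \<Sum>j<n. e i * B $$ (i, j) * p i * q j)"
    using Bc by (simp add: mat_act_def sum_distrib_left mult_ac)
  also have "\<dots> = (\<Sum>i<n. \<Sum>j<n. e j * B $$ (j, i) * p i * q j)"
    using symB by (intro sum.cong) auto
  also have "\<dots> = (\<Sum>j<n. \<Sum>i<n. e j * B $$ (j, i) * p i * q j)" by (rule sum.swap)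
  also have "\<dots> = (\<Sum>i<n. e i * q i * mat_act B p i)"
    using Bc by (simp add: mat_act_def sum_distrib_left mult_ac)
  finally have swap: "(\<Sum>i<n. e i * p i * mat_act B q i) - (\<Sum>i<n. e i * q i * mat_act B p i) = 0"
    by simp
  \<comment> \<open>\<open>S\<close> is the weighted squared norm of \<open>x\<close> multiplying
    \<open>\<mu>\<close> when the eigenvector equation is paired with the conjugate of
    \<open>x\<close>. The imaginary part of that pairing is the difference in \<open>swap\<close>,
    the real part a sum of two values of the quadratic form.\<close>
  define S where "S = (\<Sum>i<n. e i * d i * ((p i)\<^sup>2 + (q i)\<^sup>2))"
  have "(\<Sum>i<n. e i * p i * mat_act B q i) - (\<Sum>i<n. e i * q i * mat_act B p i) = Im \<mu> * S"
    unfolding S_def sum_distrib_left sum_subtractf[symmetric]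
    by (intro sum.cong) (auto simp: re im power2_eq_square algebra_simps)
  with swap have imS: "Im \<mu> * S = 0" by simp
  have "(\<Sum>i<n. e i * p i * mat_act B p i) + (\<Sum>i<n. e i * q i * mat_act B q i) = Re \<mu> * S"
    unfolding S_def sum_distrib_left sum.distrib[symmetric]
    by (intro sum.cong) (auto simp: re im power2_eq_square algebra_simps)
  then have reS: "0 \<le> Re \<mu> * S" using psd[of p] psd[of q] by simp
  have S: "0 < S"
  proof -
    obtain i where i: "i < n" "x i \<noteq> 0" using x by auto
    then have "0 < e i * d i * ((p i)\<^sup>2 + (q i)\<^sup>2)"
      using e(1)[OF i(1)] d[OF i(1)] by (simp add: p_def q_def complex_eq_iff sum_power2_gt_zero_iff)
    then show ?thesis unfolding S_def
      using e(1) d i by (intro sum_pos2[of _ i]) (auto simp: less_imp_le)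
  qed
  have "Im \<mu> = 0" "0 \<le> Re \<mu>" using imS reS S by (auto simp: zero_le_mult_iff)
  moreover have "\<mu> \<noteq> 0"
  proof
    assume "\<mu> = 0"
    then have "x i = 0" if "i < n" for i
      using real_injective_complex[OF Bc inj, of x] ev that by simp
    with x show False by auto
  qed
  ultimately show "0 < Re \<mu>" by (auto simp: complex_eq_iff)
qed

text \<open>The Routh-Hurwitz criterion in dimension two: positive trace and determinant exclude
  roots of the characteristic polynomial from the closed left half-plane.\<close>

lemma two_by_two_stable:
  fixes \<mu> x y :: complex and a b c d :: real
  assumes "0 < a + d" "0 < a * d - b * c"
    and eq: "a * x + b * y = \<mu> * x" "c * x + d * y = \<mu> * y" and ne: "x \<noteq> 0 \<or> y \<noteq> 0"
  shows "0 < Re \<mu>"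
proof (rule ccontr)
  assume neg: "\<not> 0 < Re \<mu>"
  \<comment> \<open>Multiplying the two equations by the adjugate of the shifted matrix shows that
    its determinant annihilates both coordinates.\<close>
  have "((a - \<mu>) * (d - \<mu>) - b * c) * x
      = (d - \<mu>) * (a * x + b * y - \<mu> * x) - b * (c * x + d * y - \<mu> * y)"
    "((a - \<mu>) * (d - \<mu>) - b * c) * y
      = (a - \<mu>) * (c * x + d * y - \<mu> * y) - c * (a * x + b * y - \<mu> * x)"
    by (simp_all add: algebra_simps)
  then have "((a - \<mu>) * (d - \<mu>) - b * c) * x = 0" "((a - \<mu>) * (d - \<mu>) - b * c) * y = 0"
    using eq by simp_all
  then have char: "(a - \<mu>) * (d - \<mu>) = b * c" using ne by auto
  from arg_cong[OF char, of Re] have re: "(Re \<mu>)\<^sup>2 - (a + d) * Re \<mu> + (a * d - b * c) = (Im \<mu>)\<^sup>2"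
    by (simp add: power2_eq_square algebra_simps)
  \<comment> \<open>With nonpositive real part the second factor is negative, so
    \<open>\<mu>\<close> is real; at a nonpositive real number the characteristic polynomial is
    positive.\<close>
  from arg_cong[OF char, of Im] have "Im \<mu> * (2 * Re \<mu> - (a + d)) = 0"
    by (simp add: algebra_simps)
  moreover have "2 * Re \<mu> - (a + d) < 0" using neg assms(1) by simp
  ultimately have "Im \<mu> = 0" by auto
  moreover have "0 \<le> - (a + d) * Re \<mu>" using neg assms(1) by (intro mult_nonpos_nonpos) auto
  ultimately show False using re assms(2) zero_le_power2[of "Re \<mu>"] by (simp add: algebra_simps)
qed

subsection \<open>The case of two dimensions\<close>

text \<open>The matrix being updated has rows (a, -b) and (-c, d). Its null vector forces ad = bc,
  the terms quadratic in the update cancel, and the product of \<open>w\<close>, the adjugate and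
  \<open>v\<close> remains. The signs are chosen so that all four letters are nonnegative for an
  M-matrix.\<close>

lemma singular_two_by_two_update_det:
  fixes a b c d p q v0 v1 w0 w1 :: real
  assumes ker: "a * p = b * q" "d * q = c * p" "p \<noteq> 0 \<or> q \<noteq> 0"
  shows "(a + v0 * w0) * (d + v1 * w1) - (v0 * w1 - b) * (v1 * w0 - c)
    = a * v1 * w1 + d * v0 * w0 + b * v1 * w0 + c * v0 * w1"
proof -
  have "(a * d - b * c) * p = d * (a * p - b * q) + b * (d * q - c * p)"
    "(a * d - b * c) * q = a * (d * q - c * p) + c * (a * p - b * q)"
    by (simp_all add: algebra_simps)
  then have "a * d = b * c" using ker by auto
  then show ?thesis by (simp add: algebra_simps)
qed

lemma real_injective_two_det_nonzero:
  assumes B: "B \<in> carrier_mat 2 2" and inj: "real_injective 2 B"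
  shows "B $$ (0, 0) * B $$ (1, 1) - B $$ (0, 1) * B $$ (1, 0) \<noteq> 0"
proof
  assume det: "B $$ (0, 0) * B $$ (1, 1) - B $$ (0, 1) * B $$ (1, 0) = 0"
  have ker: "x0 = 0 \<and> x1 = 0" if "B $$ (0, 0) * x0 + B $$ (0, 1) * x1 = 0"
    "B $$ (1, 0) * x0 + B $$ (1, 1) * x1 = 0" for x0 x1
  proof -
    define x where "x i = (if i = 0 then x0 else x1)" for i :: nat
    have "\<forall>i<2. mat_act B x i = 0"
      using that B by (auto simp: mat_act_def x_def numeral_2_eq_2 less_Suc_eq)
    then have "\<forall>i<2. x i = 0" using inj unfolding real_injective_def by blast
    then have "x 0 = 0" "x 1 = 0" by auto
    then show ?thesis by (simp add: x_def)
  qed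
  \<comment> \<open>For zero determinant the columns of the adjugate are null vectors, so all
    entries of \<open>B\<close> vanish; then (1, 0) is a nonzero null vector.\<close>
  have "B $$ (1, 1) = 0 \<and> - B $$ (1, 0) = 0" using det by (intro ker) (simp_all add: algebra_simps)
  moreover have "- B $$ (0, 1) = 0 \<and> B $$ (0, 0) = 0" using det by (intro ker) (simp_all add: algebra_simps)
  ultimately have "(1::real) = 0 \<and> (0::real) = 0" by (intro ker) simp_all
  then show False by simp
qed

text \<open>The i-th unit vector serves as test vector in \<open>collatz_wielandt\<close>; this
  makes the diagonal of the M-matrix nonnegative.\<close>

lemma diag_entry_le_spectral_radius:
  assumes H: "H \<in> carrier_mat n n" "nonneg_mat H" and i: "i < n"
  shows "H $$ (i, i) \<le> real_spectral_radius H"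
proof (rule collatz_wielandt[OF H, of "\<lambda>j. if j = i then 1 else 0" i])
  fix k assume "k < n"
  moreover have "mat_act H (\<lambda>j. if j = i then 1 else 0) k = H $$ (k, i)"
    using H(1) i by (simp add: mat_act_def if_distrib[of "\<lambda>x. _ * x"] cong: if_cong)
  ultimately show "H $$ (i, i) * (if k = i then 1 else 0) \<le> mat_act H (\<lambda>j. if j = i then 1 else 0) k"
    using H i by (auto simp: nonneg_mat_def)
qed (use i in auto)

text \<open>In dimension two the blocks have size 1, and the identity and the swap each single out
  one off-diagonal entry.\<close>

lemma irreducible_two_by_two:
  assumes A: "A \<in> carrier_mat 2 2" and irr: "irreducible_mat A"
  shows "A $$ (0, 1) \<noteq> 0" "A $$ (1, 0) \<noteq> 0"
proof -
  have nz: "A $$ (p 1, p 0) \<noteq> 0" if "p permutes {..<2}" for p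
  proof
    assume "A $$ (p 1, p 0) = 0"
    then have "\<forall>i j. 1 \<le> i \<longrightarrow> i < 2 \<longrightarrow> j < (1::nat) \<longrightarrow> A $$ (p i, p j) = 0"
      by (auto simp: numeral_2_eq_2 less_Suc_eq)
    moreover have "(0::nat) < 1" "(1::nat) < 2" by simp_all
    ultimately show False using irr that A unfolding irreducible_mat_def Let_def
      by (metis carrier_matD(1))
  qed
  show "A $$ (1, 0) \<noteq> 0" using nz[of id] by (simp add: permutes_id)
  have "Transposition.transpose 0 1 permutes {..<2::nat}" by (rule permutes_swap_id) auto
  from nz[OF this] show "A $$ (0, 1) \<noteq> 0" by (simp add: transpose_def)
qed

lemma D_stable_two_by_two:
  assumes H: "H \<in> carrier_mat 2 2" "nonneg_mat H"
    and A: "A = real_spectral_radius H \<cdot>\<^sub>m 1\<^sub>m 2 - H"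
    and right: "eigenvector A z 0"
    and v: "v \<in> carrier_vec 2" "nonneg_vec v" and w: "w \<in> carrier_vec 2" "nonneg_vec w"
    and cases: "irreducible_mat A \<or> pos_vec v \<and> pos_vec w"
    and inj: "real_injective 2 (A + outer_mat v w)"
  shows "D_stable (A + outer_mat v w)"
proof -
  let ?B = "A + outer_mat v w"
  have Ac: "A \<in> carrier_mat 2 2" unfolding A using H by (intro minus_carrier_mat) auto
  have Bc: "?B \<in> carrier_mat 2 2" using Ac v w by (simp add: outer_mat_def)
  define a b c d where "a = A $$ (0, 0)" and "b = - A $$ (0, 1)" and "c = - A $$ (1, 0)"
    and "d = A $$ (1, 1)"
  note abcd = a_def b_def c_def d_def
  have abcd_nonneg: "0 \<le> a" "0 \<le> b" "0 \<le> c" "0 \<le> d"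
    using H diag_entry_le_spectral_radius[OF H] by (auto simp: abcd A nonneg_mat_def)
  have vw_nonneg: "0 \<le> v $ 0" "0 \<le> v $ 1" "0 \<le> w $ 0" "0 \<le> w $ 1"
    using v w by (auto simp: nonneg_vec_def)
  have z: "z \<in> carrier_vec 2" "z \<noteq> 0\<^sub>v 2" "A *\<^sub>v z = 0 \<cdot>\<^sub>v z"
    using right Ac by (auto simp: eigenvector_def)
  have zne: "z $ 0 \<noteq> 0 \<or> z $ 1 \<noteq> 0"
    using z(1,2) by (auto simp: vec_eq_iff numeral_2_eq_2 less_Suc_eq)
  have "(A *\<^sub>v z) $ 0 = 0" "(A *\<^sub>v z) $ 1 = 0" using z by simp_all
  then have ker: "a * z $ 0 = b * z $ 1" "d * z $ 1 = c * z $ 0"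
    using z(1) Ac by (auto simp: abcd scalar_prod_def numeral_2_eq_2 algebra_simps)
  have entries: "?B $$ (0, 0) = a + v $ 0 * w $ 0" "?B $$ (0, 1) = v $ 0 * w $ 1 - b"
    "?B $$ (1, 0) = v $ 1 * w $ 0 - c" "?B $$ (1, 1) = d + v $ 1 * w $ 1"
    using Ac v w by (auto simp: abcd outer_mat_def)
  have "0 \<le> ?B $$ (0, 0) * ?B $$ (1, 1) - ?B $$ (0, 1) * ?B $$ (1, 0)"
    unfolding entries singular_two_by_two_update_det[OF ker zne]
    using abcd_nonneg vw_nonneg by simp
  then have det: "0 < ?B $$ (0, 0) * ?B $$ (1, 1) - ?B $$ (0, 1) * ?B $$ (1, 0)"
    using real_injective_two_det_nonzero[OF Bc inj] by simp
  have diag: "0 < ?B $$ (0, 0) \<and> 0 < ?B $$ (1, 1)"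
  proof (cases "pos_vec v \<and> pos_vec w")
    case True
    then have "0 < v $ 0 * w $ 0" "0 < v $ 1 * w $ 1" using v w by (auto simp: pos_vec_def)
    then show ?thesis unfolding entries using abcd_nonneg by simp
  next
    case False
    then have "b > 0" "c > 0"
      using cases irreducible_two_by_two[OF Ac] abcd_nonneg by (auto simp: abcd)
    \<comment> \<open>If \<open>a\<close> were zero, the first equation of \<open>ker\<close> would
      give \<open>z $ 1 = 0\<close> and the second \<open>z $ 0 = 0\<close>, contradicting
      \<open>zne\<close>; the argument for \<open>d\<close> is symmetric.\<close>
    then have "a \<noteq> 0" "d \<noteq> 0" using ker zne by auto
    then have "a > 0" "d > 0" using abcd_nonneg by simp_all
    then show ?thesis unfolding entries using vw_nonneg by (simp add: add_pos_nonneg)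
  qed
  show ?thesis
  proof (rule D_stableI[OF Bc])
    fix e :: "nat \<Rightarrow> real" and x :: "nat \<Rightarrow> complex" and \<mu> :: complex
    assume e: "\<And>i. i < 2 \<Longrightarrow> 0 < e i" and x: "\<exists>i<2. x i \<noteq> 0"
      and ev: "\<And>i. i < 2 \<Longrightarrow> mat_act (map_mat complex_of_real ?B) x i = \<mu> * complex_of_real (e i) * x i"
    have act: "mat_act (map_mat complex_of_real ?B) x i = ?B $$ (i, 0) * x 0 + ?B $$ (i, 1) * x 1"
      if "i < 2" for i
      using Bc that by (simp add: mat_act_def numeral_2_eq_2 del: index_add_mat)
    have e0: "0 < e 0" "0 < e 1" using e by simp_all
    \<comment> \<open>Moving the weights back to the left gives a row scaling of \<open>?B\<close>:
      the diagonal stays positive and the determinant is divided by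
      \<open>e 0 * e 1\<close>.\<close>
    let ?m = "\<lambda>i j. ?B $$ (i, j) / e i"
    show "0 < Re \<mu>"
    proof (rule two_by_two_stable)
      show "0 < ?m 0 0 + ?m 1 1" using diag e0 by (simp add: add_pos_pos)
      have "?m 0 0 * ?m 1 1 - ?m 0 1 * ?m 1 0
          = (?B $$ (0, 0) * ?B $$ (1, 1) - ?B $$ (0, 1) * ?B $$ (1, 0)) / (e 0 * e 1)"
        by (simp add: diff_divide_distrib mult.commute)
      then show "0 < ?m 0 0 * ?m 1 1 - ?m 0 1 * ?m 1 0" using det e0 by simp
      show "?m 0 0 * x 0 + ?m 0 1 * x 1 = \<mu> * x 0" "?m 1 0 * x 0 + ?m 1 1 * x 1 = \<mu> * x 1"
        using ev[of 0] ev[of 1] act[of 0] act[of 1] e0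
        by (simp_all add: field_simps del: index_add_mat)
      show "x 0 \<noteq> 0 \<or> x 1 \<noteq> 0" using x by (auto simp: numeral_2_eq_2 less_Suc_eq)
    qed
  qed
qed

lemma positive_diagonal_mat_diag:
  assumes "\<And>i. i < n \<Longrightarrow> 0 < d i"
  shows "positive_diagonal_mat n (mat_diag n d)"
  using assms by (auto simp: positive_diagonal_mat_def diagonal_mat_def mat_diag_def)

subsection \<open>Diagonal symmetrizability\<close>

lemma ex_positive_diagonal_mat:
  "(\<exists>D. positive_diagonal_mat n D \<and> P D) \<longleftrightarrow> (\<exists>d. (\<forall>i<n. 0 < d i) \<and> P (mat_diag n d))"
proof
  assume "\<exists>D. positive_diagonal_mat n D \<and> P D"
  then obtain D where D: "positive_diagonal_mat n D" "P D" by auto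
  then have "P (mat_diag n (\<lambda>i. D $$ (i, i)))" by (simp add: mat_diag_of_positive_diagonal)
  moreover have "\<forall>i<n. 0 < D $$ (i, i)" using D(1) by (simp add: positive_diagonal_mat_def)
  ultimately show "\<exists>d. (\<forall>i<n. 0 < d i) \<and> P (mat_diag n d)"
    by (intro exI[of _ "\<lambda>i. D $$ (i, i)"] conjI)
next
  assume "\<exists>d. (\<forall>i<n. 0 < d i) \<and> P (mat_diag n d)"
  then obtain d where d: "\<forall>i<n. 0 < d i" "P (mat_diag n d)" by auto
  then show "\<exists>D. positive_diagonal_mat n D \<and> P D"
    using positive_diagonal_mat_diag[of n d] by (intro exI[of _ "mat_diag n d"]) simp
qed

text \<open>A common form for conditions (a), (b) and (c), which then differ only in the weights:
  squares, arbitrary positive weights, or the quotients of \<open>w\<close> by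
  \<open>v\<close>.\<close>

definition row_scaling_symmetric :: "nat \<Rightarrow> (nat \<Rightarrow> real) \<Rightarrow> real mat \<Rightarrow> bool" where
  "row_scaling_symmetric n e M \<longleftrightarrow> (\<forall>i<n. \<forall>j<n. e i * M $$ (i, j) = e j * M $$ (j, i))"

lemma symmetric_mat_iff:
  assumes "M \<in> carrier_mat n n"
  shows "symmetric_mat M \<longleftrightarrow> (\<forall>i<n. \<forall>j<n. M $$ (i, j) = M $$ (j, i))"
  using assms unfolding symmetric_mat_def by (auto simp: mat_eq_iff)

lemma symmetric_mat_diag_mult:
  assumes M: "M \<in> carrier_mat n n"
  shows "symmetric_mat (mat_diag n e * M) \<longleftrightarrow> row_scaling_symmetric n e M"
proof -
  have "mat_diag n e * M \<in> carrier_mat n n" using M mat_diag_dim by (metis mult_carrier_mat)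
  from symmetric_mat_iff[OF this] show ?thesis
    by (simp add: mat_diag_mult_left[OF M] row_scaling_symmetric_def)
qed

text \<open>Conjugation multiplies the (i, j) entry by \<open>d i / d j\<close>; clearing
  denominators with \<open>d i * d j\<close> leaves squared weights.\<close>

lemma symmetric_mat_diag_conjugate:
  assumes M: "M \<in> carrier_mat n n" and d: "\<forall>i<n. 0 < d i"
  shows "symmetric_mat (mat_diag n d * M * inverse_mat (mat_diag n d))
    \<longleftrightarrow> row_scaling_symmetric n (\<lambda>i. (d i)\<^sup>2) M"
proof -
  have inv: "inverse_mat (mat_diag n d) = mat_diag n (\<lambda>i. inverse (d i))"
    using inverse_mat_positive_diagonal[OF positive_diagonal_mat_diag[of n d]] d
    by (auto simp: mat_diag_def intro!: eq_matI)
  have "mat_diag n d * M * inverse_mat (mat_diag n d)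
      = mat n n (\<lambda>(i, j). d i * M $$ (i, j) * inverse (d j))"
    unfolding inv mat_diag_mult_left[OF M] by (subst mat_diag_mult_right[of _ n]) (auto intro!: eq_matI)
  moreover have "d i * M $$ (i, j) * inverse (d j) = d j * M $$ (j, i) * inverse (d i)
      \<longleftrightarrow> (d i)\<^sup>2 * M $$ (i, j) = (d j)\<^sup>2 * M $$ (j, i)" if "i < n" "j < n" for i j
  proof -
    have "0 < d i" "0 < d j" using d that by auto
    then show ?thesis by (simp add: field_simps power2_eq_square)
  qed
  ultimately show ?thesis
    by (simp add: symmetric_mat_iff[of _ n] row_scaling_symmetric_def)
qed

lemma row_scaling_symmetric_outer:
  assumes "v \<in> carrier_vec n" "w \<in> carrier_vec n" "pos_vec v"
  shows "row_scaling_symmetric n (\<lambda>i. w $ i / v $ i) (outer_mat v w)"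
  using assms by (auto simp: row_scaling_symmetric_def outer_mat_def pos_vec_def field_simps)

text \<open>Symmetry of the scaled rank-one matrix determines the weights up to a common factor:
  they are proportional to \<open>w $ i / v $ i\<close>, and proportional weights symmetrize the
  same matrices.\<close>

lemma row_scaling_symmetric_unique:
  assumes vw: "v \<in> carrier_vec n" "w \<in> carrier_vec n" "pos_vec v" "pos_vec w"
    and e: "\<forall>i<n. 0 < e i"
    and A: "row_scaling_symmetric n e A" and out: "row_scaling_symmetric n e (outer_mat v w)"
  shows "row_scaling_symmetric n (\<lambda>i. w $ i / v $ i) A"
  unfolding row_scaling_symmetric_def
proof (intro allI impI)
  fix i j assume ij: "i < n" "j < n"
  have pos: "0 < v $ i" "0 < v $ j" "0 < w $ i" "0 < w $ j" "0 < e i" "0 < e j"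
    using vw e ij by (auto simp: pos_vec_def)
  have "e i * (v $ i * w $ j) = e j * (v $ j * w $ i)"
    using out vw ij by (auto simp: row_scaling_symmetric_def outer_mat_def)
  then have ratio: "w $ i / v $ i = e i * (w $ j / (v $ j * e j))"
    using pos by (simp add: field_simps)
  have "w $ i / v $ i * A $$ (i, j) = w $ j / (v $ j * e j) * (e i * A $$ (i, j))"
    unfolding ratio by simp
  also have "e i * A $$ (i, j) = e j * A $$ (j, i)"
    using A ij by (simp add: row_scaling_symmetric_def)
  finally show "w $ i / v $ i * A $$ (i, j) = w $ j / v $ j * A $$ (j, i)"
    using pos by simp
qed

section \<open>The three cases and the equivalence of the symmetry conditions\<close>

theorem corollary2p14:
  fixes n :: nat and H A :: "real mat" and z_l z_r v w :: "real vec"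
  assumes H: "H \<in> carrier_mat n n" "nonneg_mat H"
    and A: "A = real_spectral_radius H \<cdot>\<^sub>m 1\<^sub>m n - H"
    and simple: "geometrically_simple A 0"
    and left: "eigenvector (transpose_mat A) z_l 0"
    and right: "eigenvector A z_r 0"
    and v: "v \<in> carrier_vec n" and w: "w \<in> carrier_vec n"
    and nz: "(z_l \<bullet> v) * (w \<bullet> z_r) \<noteq> 0"
  shows
    "(n = 2 \<and> nonneg_vec v \<and> nonneg_vec w \<and>
        (irreducible_mat A \<or> (pos_vec v \<and> pos_vec w))
        \<longrightarrow> D_stable (A + outer_mat v w))
     \<and>
     (pos_vec v \<and> pos_vec w \<longrightarrow>
        (let cond_a = (\<exists>D. positive_diagonal_mat n D \<and>
                         symmetric_mat (D * A * inverse_mat D) \<and>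
                         symmetric_mat (D * outer_mat v w * inverse_mat D));
             cond_b = (\<exists>E. positive_diagonal_mat n E \<and>
                         symmetric_mat (E * A) \<and> symmetric_mat (E * outer_mat v w));
             cond_c = (let E = diag_of_vec w * inverse_mat (diag_of_vec v)
                       in symmetric_mat (E * A))
         in (cond_a \<longleftrightarrow> cond_b) \<and> (cond_b \<longleftrightarrow> cond_c) \<and>
            (cond_a \<or> cond_b \<or> cond_c \<longrightarrow> D_stable (A + outer_mat v w))))
     \<and>
     (pos_vec v \<and> pos_vec w \<and> (\<forall>i < n. \<forall>j < n. v $ i * w $ j \<le> 2 * H $$ (i, j))
        \<longrightarrow> D_stable (A + outer_mat v w))"
proof -
  have Ac: "A \<in> carrier_mat n n" unfolding A using H by (intro minus_carrier_mat) auto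
  have Oc: "outer_mat v w \<in> carrier_mat n n" using v w by (simp add: outer_mat_def)
  have inj: "real_injective n (A + outer_mat v w)"
    using rank_one_update_nonsingular[OF Ac simple left right v w nz]
    unfolding real_injective_def by blast
  have B: "A + outer_mat v w = real_spectral_radius H \<cdot>\<^sub>m 1\<^sub>m n - H + outer_mat v w"
    by (simp add: A)
  have i: "D_stable (A + outer_mat v w)"
    if "n = 2" "nonneg_vec v" "nonneg_vec w" "irreducible_mat A \<or> (pos_vec v \<and> pos_vec w)"
    using D_stable_two_by_two[of H A z_r v w] H A right v w inj that by simp
  have iii: "D_stable (A + outer_mat v w)"
    if "pos_vec v" "pos_vec w" "\<forall>i < n. \<forall>j < n. v $ i * w $ j \<le> 2 * H $$ (i, j)"
    using D_stable_of_dominated[OF H(1) v that(1) w that(2) _ B inj] that(3) by blast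
  define a where "a \<longleftrightarrow> (\<exists>D. positive_diagonal_mat n D \<and>
      symmetric_mat (D * A * inverse_mat D) \<and> symmetric_mat (D * outer_mat v w * inverse_mat D))"
  define b where "b \<longleftrightarrow> (\<exists>E. positive_diagonal_mat n E \<and>
      symmetric_mat (E * A) \<and> symmetric_mat (E * outer_mat v w))"
  define c where "c \<longleftrightarrow> symmetric_mat (diag_of_vec w * inverse_mat (diag_of_vec v) * A)"
  have ii: "(a \<longleftrightarrow> b) \<and> (b \<longleftrightarrow> c) \<and> (a \<or> b \<or> c \<longrightarrow> D_stable (A + outer_mat v w))"
    if pv: "pos_vec v" and pw: "pos_vec w"
  proof -
    let ?e = "\<lambda>i. w $ i / v $ i"
    have e: "0 < ?e i" if "i < n" for i using pv pw v w that by (auto simp: pos_vec_def)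
    have "inverse_mat (diag_of_vec v) = mat_diag n (\<lambda>i. inverse (v $ i))"
      using inverse_mat_positive_diagonal[OF positive_diagonal_mat_diag[of n "($) v"]] pv v
      by (auto simp: pos_vec_def diag_of_vec_def mat_diag_def intro!: eq_matI)
    then have "diag_of_vec w * inverse_mat (diag_of_vec v) = mat_diag n ?e"
      using w by (simp add: diag_of_vec_def divide_inverse)
    then have c: "c \<longleftrightarrow> row_scaling_symmetric n ?e A"
      by (simp add: c_def symmetric_mat_diag_mult[OF Ac])
    have b: "b \<longleftrightarrow> (\<exists>e. (\<forall>i<n. 0 < e i) \<and>
        row_scaling_symmetric n e A \<and> row_scaling_symmetric n e (outer_mat v w))"
      unfolding b_def ex_positive_diagonal_mat symmetric_mat_diag_mult[OF Ac]
        symmetric_mat_diag_mult[OF Oc] ..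
    have a: "a \<longleftrightarrow> (\<exists>d. (\<forall>i<n. 0 < d i) \<and> row_scaling_symmetric n (\<lambda>i. (d i)\<^sup>2) A
        \<and> row_scaling_symmetric n (\<lambda>i. (d i)\<^sup>2) (outer_mat v w))"
      unfolding a_def ex_positive_diagonal_mat
      using symmetric_mat_diag_conjugate[OF Ac] symmetric_mat_diag_conjugate[OF Oc] by blast
    have ab: "a \<longrightarrow> b"
    proof
      assume a
      then obtain d where d: "\<forall>i<n. 0 < d i" "row_scaling_symmetric n (\<lambda>i. (d i)\<^sup>2) A"
        "row_scaling_symmetric n (\<lambda>i. (d i)\<^sup>2) (outer_mat v w)" unfolding a by auto
      then show b unfolding b by (intro exI[of _ "\<lambda>i. (d i)\<^sup>2"]) auto
    qed
    have bc: "b \<longrightarrow> c"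
      unfolding b c using row_scaling_symmetric_unique[OF v w pv pw] by blast
    have ca: "c \<longrightarrow> a"
    proof
      assume c
      \<comment> \<open>Conjugation corresponds to squared weights, so the diagonal matrix for (a)
        consists of the square roots of \<open>w $ i / v $ i\<close>.\<close>
      moreover have "row_scaling_symmetric n (\<lambda>i. (sqrt (?e i))\<^sup>2) M \<longleftrightarrow> row_scaling_symmetric n ?e M" for M
        using e by (simp add: row_scaling_symmetric_def less_imp_le)
      ultimately show a unfolding a c
        using row_scaling_symmetric_outer[OF v w pv] e by (intro exI[of _ "\<lambda>i. sqrt (?e i)"]) auto
    qed
    have "D_stable (A + outer_mat v w)" if c
    proof (rule D_stable_of_symmetrizable[OF H(1) v w, of ?e, OF e _ _ B inj])
      show "w $ i = ?e i * v $ i" if "i < n" for i using pv v that by (auto simp: pos_vec_def)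
      fix i j assume ij: "i < n" "j < n"
      then have "?e i * A $$ (i, j) = ?e j * A $$ (j, i)"
        using \<open>c\<close> unfolding c row_scaling_symmetric_def by blast
      \<comment> \<open>Off the diagonal \<open>A\<close> is the negative of \<open>H\<close>; on
        the diagonal the equation is trivial.\<close>
      then show "?e i * H $$ (i, j) = ?e j * H $$ (j, i)"
        using ij H(1) by (cases "i = j") (auto simp: A)
    qed auto
    with ab bc ca show ?thesis by blast
  qed
  show ?thesis
    using i ii iii unfolding Let_def a_def b_def c_def by blast
qed

end
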